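(* Let $n\ge 1$ and let $\mathbf{m}=(m_1,\dots,m_n)$, $\mathbf{r}=(r_1,\dots,r_n)$ be vectors of positive integers, $m=m_1+\cdots+m_n$, $r=\max\{r_1,\dots,r_n\}$. Then, as formal power series in the variables $z_{k^l}$ ($1\le k\le n$, $1\le l\le r_k$), $y_1,\dots,y_r$ and $z_{m+1}$, $$\sum_{\pi^{\mathbf{c}}\in\mathfrak{S}_{\mathbf{m}}^{\mathbf{r}}}\frac{\prod_{p=1}^{r}y_p^{c_p(\pi^{\mathbf{c}})}\prod_{\substack{i\in\{2,\dots,m+1\}\\ i-1\in\mathrm{DES}(\pi^{\mathbf{c}})}}z_{\pi_i^{c_i}}^{r_{\pi_i}}\cdots z_{\pi_m^{c_m}}^{r_{\pi_m}}z_{m+1}}{\prod_{i=1}^{m+1}\bigl(1-z_{\pi_i^{c_i}}^{r_{\pi_i}}\cdots z_{\pi_m^{c_m}}^{r_{\pi_m}}z_{m+1}\bigr)}=\sum_{t\ge0}z_{m+1}^t\prod_{k=1}^n\left(\sum_{(i_{1;k},\dots,i_{r_k;k})}\ \prod_{l=1}^{r_k}\begin{bmatrix}t+\lfloor\frac{1-l}{l}\rfloor+i_{l;k}\\ i_{l;k}\end{bmatrix}_{z_{k^l}^{r_k}}y_l^{i_{l;k}}\right),$$ where, for each $k$, the inner sum is over all tuples of nonnegative integers $(i_{1;k},\dots,i_{r_k;k})$ with $i_{1;k}+\cdots+i_{r_k;k}=m_k$. For $i=m+1$ the expression $z_{\pi_i^{c_i}}^{r_{\pi_i}}\cdots z_{\pi_m^{c_m}}^{r_{\pi_m}}z_{m+1}$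 is just $z_{m+1}$.
   Context: $\mathfrak{S}_{\mathbf{m}}^{\mathbf{r}}$ denotes the set of colored multiset permutations: words $\pi^{\mathbf{c}}=\pi_1^{c_1}\pi_2^{c_2}\cdots\pi_m^{c_m}$ in which each $k\in\{1,\dots,n\}$ appears exactly $m_k$ times among $\pi_1,\dots,\pi_m$, and each color $c_j$ is an integer with $1\le c_j\le r_{\pi_j}$. One always appends $\pi_{m+1}^{c_{m+1}}:=(n+1)^1$. Colored letters are totally ordered by the color ordering: $k^{c}<l^{c'}$ iff $c<c'$, or $c=c'$ and $k<l$. An index $j\in\{1,\dots,m\}$ is a descent of $\pi^{\mathbf{c}}$ if $\pi_j^{c_j}>\pi_{j+1}^{c_{j+1}}$; $\mathrm{DES}(\pi^{\mathbf{c}})$ is the set of descents. For $p\in\{1,\dots,r\}$, $c_p(\pi^{\mathbf{c}})$ is the number of $j\in\{1,\dots,m\}$ with $c_j=p$ (the appended letter is not counted). $\begin{bmatrix}N\\ M\end{bmatrix}_q$ is the Gaussian ($q$-)binomial coefficient $\prod_{i=1}^{M}\frac{1-q^{N-M+i}}{1-q^i}$, equal to $1$ when $M=0$ and to $0$ when $N=M-1$, $M\ge1$. $\lfloor\cdot\rfloor$ is the floor function. *)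

theory Defs
  imports Complex_Main "HOL-Library.Multiset" "HOL-Library.FuncSet"
begin

section \<open>Formal power series in several variables\<close>

text \<open>
  A monomial in variables from \<^typ>\<open>'v\<close> is the finite multiset of its variables (so monomials
  multiply by multiset addition), and a power series is an arbitrary family of coefficients
  indexed by monomials.
\<close>

typedef ('v, 'a) mps = "UNIV :: ('v multiset \<Rightarrow> 'a) set"
  morphisms mps_coeff Abs_mps ..

setup_lifting type_definition_mps

lemma mps_eqI: "(\<And>M. mps_coeff f M = mps_coeff g M) \<Longrightarrow> f = g"
  by transfer auto

lemma finite_multiset_splits: "finite {(A, B). A + B = (M :: 'v multiset)}"
proof (induction M)
  case empty
  have "{(A, B). A + B = ({#} :: 'v multiset)} = {({#}, {#})}" by auto
  then show ?case by simp
next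
  case (add x M)
  let ?S = "{(A, B). A + B = M}"
  have "{(A, B). A + B = add_mset x M}
      \<subseteq> (\<lambda>(A, B). (add_mset x A, B)) ` ?S \<union> (\<lambda>(A, B). (A, add_mset x B)) ` ?S"
  proof
    fix p assume "p \<in> {(A, B). A + B = add_mset x M}"
    then obtain A B where p: "p = (A, B)" and AB: "A + B = add_mset x M" by auto
    have "x \<in># A + B" by (simp add: AB)
    then consider "x \<in># A" | "x \<in># B" by auto
    then show "p \<in> (\<lambda>(A, B). (add_mset x A, B)) ` ?S \<union> (\<lambda>(A, B). (A, add_mset x B)) ` ?S"
    proof cases
      case 1
      then obtain A' where "A = add_mset x A'" by (metis insert_DiffM)
      with p AB show ?thesis by (auto intro!: image_eqI[of _ _ "(A', B)"])
    next
      case 2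
      then obtain B' where "B = add_mset x B'" by (metis insert_DiffM)
      with p AB show ?thesis by (auto intro!: image_eqI[of _ _ "(A, B')"])
    qed
  qed
  then show ?case using add.IH by (meson finite_UnI finite_imageI finite_subset)
qed

instantiation mps :: (type, comm_ring_1) comm_ring_1
begin

lift_definition zero_mps :: "('a, 'b) mps" is "\<lambda>_. 0" .
lift_definition one_mps :: "('a, 'b) mps" is "\<lambda>M. if M = {#} then 1 else 0" .
lift_definition plus_mps :: "('a, 'b) mps \<Rightarrow> ('a, 'b) mps \<Rightarrow> ('a, 'b) mps" is "\<lambda>f g M. f M + g M" .
lift_definition minus_mps :: "('a, 'b) mps \<Rightarrow> ('a, 'b) mps \<Rightarrow> ('a, 'b) mps" is "\<lambda>f g M. f M - g M" .
lift_definition uminus_mps :: "('a, 'b) mps \<Rightarrow> ('a, 'b) mps" is "\<lambda>f M. - f M" .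
lift_definition times_mps :: "('a, 'b) mps \<Rightarrow> ('a, 'b) mps \<Rightarrow> ('a, 'b) mps"
  is "\<lambda>f g M. \<Sum>(A, B) | A + B = M. f A * g B" .

instance
proof
  fix f g h :: "('a, 'b) mps"
  show "f + g + h = f + (g + h)" by transfer (auto simp: add.assoc)
  show "f + g = g + f" by transfer (auto simp: add.commute)
  show "0 + f = f" by transfer auto
  show "- f + f = 0" by transfer auto
  show "f - g = f + - g" by transfer auto
  show "(0 :: ('a, 'b) mps) \<noteq> 1" by transfer (metis zero_neq_one)
  show "(f + g) * h = f * h + g * h"
    by transfer (auto simp: distrib_right sum.distrib case_prod_unfold)
  show "f * g = g * f"
  proof (transfer, rule ext)
    fix f g :: "'a multiset \<Rightarrow> 'b" and M
    show "(\<Sum>(A, B) | A + B = M. f A * g B) = (\<Sum>(A, B) | A + B = M. g A * f B)"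
      by (rule sum.reindex_bij_witness[of _ "\<lambda>(A, B). (B, A)" "\<lambda>(A, B). (B, A)"])
         (auto simp: add.commute mult.commute)
  qed
  show "1 * f = f"
  proof (transfer, rule ext)
    fix f :: "'a multiset \<Rightarrow> 'b" and M
    have "(\<Sum>(A, B) | A + B = M. (if A = {#} then 1 else 0) * f B)
        = (\<Sum>(A, B) \<in> {({#} :: 'a multiset, M)}. (if A = {#} then 1 else 0) * f B)"
      by (rule sum.mono_neutral_right) (auto simp: finite_multiset_splits split: if_splits)
    then show "(\<Sum>(A, B) | A + B = M. (if A = {#} then 1 else 0) * f B) = f M" by simp
  qed
  show "f * g * h = f * (g * h)"
  proof (transfer, rule ext)
    fix f g h :: "'a multiset \<Rightarrow> 'b" and M
    let ?S = "\<lambda>M :: 'a multiset. {(A, B). A + B = M}"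
    have fin: "finite (?S N)" for N by (rule finite_multiset_splits)
    have "(\<Sum>(A, B) \<in> ?S M. (\<Sum>(C, D) \<in> ?S A. f C * g D) * h B)
        = (\<Sum>p \<in> ?S M. \<Sum>q \<in> ?S (fst p). f (fst q) * g (snd q) * h (snd p))"
      by (simp only: case_prod_unfold sum_distrib_right)
    also have "\<dots> = (\<Sum>(p, q) \<in> (SIGMA p:?S M. ?S (fst p)). f (fst q) * g (snd q) * h (snd p))"
      using fin by (subst sum.Sigma) auto
    also have "\<dots> = (\<Sum>(p, q) \<in> (SIGMA p:?S M. ?S (snd p)). f (fst p) * (g (fst q) * h (snd q)))"
      by (rule sum.reindex_bij_witness[of _
            "\<lambda>((A, B), (C, D)). ((A + C, D), (A, C))" "\<lambda>((A, B), (C, D)). ((C, D + B), (D, B))"])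
         (auto simp: add.assoc mult.assoc)
    also have "\<dots> = (\<Sum>p \<in> ?S M. \<Sum>q \<in> ?S (snd p). f (fst p) * (g (fst q) * h (snd q)))"
      using fin by (subst sum.Sigma) auto
    also have "\<dots> = (\<Sum>(A, B) \<in> ?S M. f A * (\<Sum>(C, D) \<in> ?S B. g C * h D))"
      by (simp only: case_prod_unfold sum_distrib_left)
    finally show "(\<Sum>(A, B) \<in> ?S M. (\<Sum>(C, D) \<in> ?S A. f C * g D) * h B)
        = (\<Sum>(A, B) \<in> ?S M. f A * (\<Sum>(C, D) \<in> ?S B. g C * h D))" .
  qed
qed

end

text \<open>Units get their ring inverse; all other series get the dummy value \<open>0\<close>.\<close>

instantiation mps :: (type, comm_ring_1) inverse
begin

definition inverse_mps :: "('a, 'b) mps \<Rightarrow> ('a, 'b) mps" where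
  "inverse_mps f = (if f dvd 1 then THE g. f * g = 1 else 0)"

definition divide_mps :: "('a, 'b) mps \<Rightarrow> ('a, 'b) mps \<Rightarrow> ('a, 'b) mps" where
  "divide_mps f g = f * inverse g"

instance ..

end

lemma mps_inverse_unique:
  fixes f g :: "('v, 'a :: comm_ring_1) mps"
  assumes "f * g = 1"
  shows "inverse f = g"
proof -
  have "f dvd 1" using assms by (metis dvd_triv_left)
  moreover have "(THE g. f * g = 1) = g"
  proof (rule the_equality[where P = "\<lambda>g. f * g = 1", OF assms])
    fix h assume h: "f * h = 1"
    have "h = h * (f * g)" by (simp add: assms)
    also have "\<dots> = (f * h) * g" by (simp only: mult.assoc mult.left_commute)
    finally show "h = g" by (simp add: h)
  qed
  ultimately show ?thesis by (simp add: inverse_mps_def)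
qed

lemma mps_mult_inverse:
  fixes f :: "('v, 'a :: comm_ring_1) mps"
  assumes "f dvd 1"
  shows "f * inverse f = 1"
proof -
  obtain g where "f * g = 1" using assms by (metis dvd_def)
  then show ?thesis by (simp add: mps_inverse_unique)
qed

lemma mps_coeff_power_eq_0:
  fixes f :: "('v, 'a :: comm_ring_1) mps"
  assumes "mps_coeff f {#} = 0" "size M < n"
  shows "mps_coeff (f ^ n) M = 0"
  using assms(2)
proof (induction n arbitrary: M)
  case (Suc n)
  have "mps_coeff f A * mps_coeff (f ^ n) B = 0" if "A + B = M" for A B
  proof (cases "A = {#}")
    case False
    then have "0 < size A" by (simp add: nonempty_has_size)
    moreover have "size A + size B = size M" using that by auto
    ultimately have "size B < n" using Suc.prems by linarith
    then show ?thesis by (simp add: Suc.IH)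
  qed (simp add: assms(1))
  then show ?case by (auto simp: times_mps.rep_eq intro!: sum.neutral)
qed simp

text \<open>In particular every denominator of the shape \<open>1 - z\<close> below is a unit.\<close>

lemma mps_one_minus_unit:
  fixes f :: "('v, 'a :: comm_ring_1) mps"
  assumes f: "mps_coeff f {#} = 0"
  shows "1 - f dvd 1"
proof -
  define S where "S N = (\<Sum>n<N. f ^ n)" for N
  have S_Suc: "mps_coeff (S (Suc N)) B = mps_coeff (S N) B" if "size B < N" for B N
    using mps_coeff_power_eq_0[OF f that] by (simp add: S_def plus_mps.rep_eq)
  have S_eq: "mps_coeff (S (Suc (size B + d))) B = mps_coeff (S (Suc (size B))) B" for B d
  proof (induction d)
    case (Suc d)
    then show ?case using S_Suc[of B "Suc (size B + d)"] by simp
  qed simp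
  define g where "g = Abs_mps (\<lambda>M. mps_coeff (S (Suc (size M))) M)"
  have g: "mps_coeff g M = mps_coeff (S (Suc (size M))) M" for M
    by (simp add: g_def Abs_mps_inverse)
  have "(1 - f) * g = 1"
  proof (rule mps_eqI)
    fix M :: "'v multiset"
    let ?N = "Suc (size M)"
    have "mps_coeff ((1 - f) * g) M = mps_coeff ((1 - f) * S ?N) M"
      unfolding times_mps.rep_eq
    proof (rule sum.cong[OF refl], clarify)
      fix A B assume "M = A + B"
      then have "?N = Suc (size B + size A)" by simp
      then show "mps_coeff (1 - f) A * mps_coeff g B
          = mps_coeff (1 - f) A * mps_coeff (S (Suc (size (A + B)))) B"
        using S_eq[of B "size A"] by (simp add: g add.commute)
    qed
    also have "(1 - f) * S ?N = 1 - f ^ ?N"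
      unfolding S_def by (rule one_diff_power_eq[symmetric])
    also have "mps_coeff (1 - f ^ ?N) M = mps_coeff 1 M"
      using mps_coeff_power_eq_0[OF f, of M ?N] by (simp add: minus_mps.rep_eq del: power_Suc)
    finally show "mps_coeff ((1 - f) * g) M = mps_coeff 1 M" .
  qed
  then show ?thesis by (metis dvd_triv_left)
qed

text \<open>
  Series carry the topology of coefficientwise convergence, the coefficients being discrete.
  An infinite sum therefore converges iff each coefficient is eventually constant along the
  partial sums.
\<close>

instantiation mps :: (type, type) t2_space
begin

definition open_mps :: "('a, 'b) mps set \<Rightarrow> bool" where
  "open_mps U \<longleftrightarrow>
     (\<forall>f\<in>U. \<exists>S. finite S \<and> (\<forall>g. (\<forall>M\<in>S. mps_coeff g M = mps_coeff f M) \<longrightarrow> g \<in> U))"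

instance
proof
  show "open (UNIV :: ('a, 'b) mps set)" by (auto simp: open_mps_def)
next
  fix U V :: "('a, 'b) mps set"
  assume U: "open U" and V: "open V"
  show "open (U \<inter> V)"
    unfolding open_mps_def
  proof
    fix f assume f: "f \<in> U \<inter> V"
    obtain S where S: "finite S" "\<forall>g. (\<forall>M\<in>S. mps_coeff g M = mps_coeff f M) \<longrightarrow> g \<in> U"
      using U f unfolding open_mps_def by blast
    obtain T where T: "finite T" "\<forall>g. (\<forall>M\<in>T. mps_coeff g M = mps_coeff f M) \<longrightarrow> g \<in> V"
      using V f unfolding open_mps_def by blast
    from S T
    show "\<exists>S. finite S \<and> (\<forall>g. (\<forall>M\<in>S. mps_coeff g M = mps_coeff f M) \<longrightarrow> g \<in> U \<inter> V)"
      by (intro exI[of _ "S \<union> T"]) auto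
  qed
next
  fix K :: "('a, 'b) mps set set"
  assume "\<forall>U\<in>K. open U"
  then have K: "\<exists>S. finite S \<and> (\<forall>g. (\<forall>M\<in>S. mps_coeff g M = mps_coeff f M) \<longrightarrow> g \<in> U)"
    if "U \<in> K" "f \<in> U" for U f
    using that by (simp add: open_mps_def)
  show "open (\<Union>K)"
    unfolding open_mps_def
  proof
    fix f assume "f \<in> \<Union>K"
    then obtain U where U: "U \<in> K" "f \<in> U" by blast
    from K[OF this] U(1)
    show "\<exists>S. finite S \<and> (\<forall>g. (\<forall>M\<in>S. mps_coeff g M = mps_coeff f M) \<longrightarrow> g \<in> \<Union>K)" by blast
  qed
next
  fix f g :: "('a, 'b) mps"
  assume "f \<noteq> g"
  then obtain M where M: "mps_coeff f M \<noteq> mps_coeff g M" using mps_eqI by blast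
  let ?U = "\<lambda>f :: ('a, 'b) mps. {h. mps_coeff h M = mps_coeff f M}"
  have "open (?U k)" for k
    unfolding open_mps_def by (intro ballI exI[of _ "{M}"]) auto
  then show "\<exists>U V. open U \<and> open V \<and> f \<in> U \<and> g \<in> V \<and> U \<inter> V = {}"
    using M by (intro exI[of _ "?U f"] exI[of _ "?U g"]) auto
qed

end

lemma mps_tendsto_iff:
  "((X :: 'c \<Rightarrow> ('v, 'a) mps) \<longlongrightarrow> L) F \<longleftrightarrow>
     (\<forall>M. eventually (\<lambda>x. mps_coeff (X x) M = mps_coeff L M) F)"
proof
  assume X: "(X \<longlongrightarrow> L) F"
  show "\<forall>M. eventually (\<lambda>x. mps_coeff (X x) M = mps_coeff L M) F"
  proof
    fix M
    have "open {h :: ('v, 'a) mps. mps_coeff h M = mps_coeff L M}"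
      unfolding open_mps_def by (intro ballI exI[of _ "{M}"]) auto
    from topological_tendstoD[OF X this]
    show "eventually (\<lambda>x. mps_coeff (X x) M = mps_coeff L M) F" by simp
  qed
next
  assume ev: "\<forall>M. eventually (\<lambda>x. mps_coeff (X x) M = mps_coeff L M) F"
  show "(X \<longlongrightarrow> L) F"
  proof (rule topological_tendstoI)
    fix U :: "('v, 'a) mps set"
    assume "open U" "L \<in> U"
    then obtain S where S: "finite S"
      "\<forall>g. (\<forall>M\<in>S. mps_coeff g M = mps_coeff L M) \<longrightarrow> g \<in> U"
      unfolding open_mps_def by blast
    have "eventually (\<lambda>x. \<forall>M\<in>S. mps_coeff (X x) M = mps_coeff L M) F"
      using ev S(1) by (simp add: eventually_ball_finite)
    then show "eventually (\<lambda>x. X x \<in> U) F"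
      by (rule eventually_mono) (use S(2) in auto)
  qed
qed

lift_definition mps_var :: "'v \<Rightarrow> ('v, 'a :: comm_ring_1) mps"
  is "\<lambda>v M. if M = {#v#} then 1 else 0" .

text \<open>
  The upper entry is an integer because \<open>N = -1\<close> does occur. For \<open>N \<ge> M - 1\<close>, the only case
  that is used, the truncation by \<^const>\<open>nat\<close> is vacuous.
\<close>

definition gauss_binomial ::
  "int \<Rightarrow> nat \<Rightarrow> ('v, 'a :: comm_ring_1) mps \<Rightarrow> ('v, 'a) mps" where
  "gauss_binomial N M q = (\<Prod>i=1..M. (1 - q ^ nat (N - int M + int i)) / (1 - q ^ i))"


section \<open>Colored multiset permutations\<close>

text \<open>\<open>ZVar k l\<close> stands for \<open>z\<close> indexed by the colored letter \<open>k\<close> of color \<open>l\<close>, and \<open>ZLast\<close>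
  for the separate variable \<open>z\<close> indexed by \<open>m + 1\<close>.\<close>

datatype var = ZVar nat nat | YVar nat | ZLast

abbreviation zvar :: "nat \<Rightarrow> nat \<Rightarrow> (var, 'a :: comm_ring_1) mps" where
  "zvar k l \<equiv> mps_var (ZVar k l)"

abbreviation yvar :: "nat \<Rightarrow> (var, 'a :: comm_ring_1) mps" where
  "yvar p \<equiv> mps_var (YVar p)"

abbreviation zlast :: "(var, 'a :: comm_ring_1) mps" where
  "zlast \<equiv> mps_var ZLast"

text \<open>A colored word is the list of its pairs (letter, color). Vectors indexed by \<open>1, \<dots>, n\<close> are
  functions on \<^typ>\<open>nat\<close> of which only the values on \<open>{1..n}\<close> matter.\<close>

definition colored_mperms :: "nat \<Rightarrow> (nat \<Rightarrow> nat) \<Rightarrow> (nat \<Rightarrow> nat) \<Rightarrow> (nat \<times> nat) list set" where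
  "colored_mperms n m r =
     {w. (\<forall>(k, c) \<in> set w. k \<in> {1..n} \<and> c \<in> {1..r k}) \<and>
         (\<forall>k\<in>{1..n}. count_list (map fst w) k = m k)}"

lemma finite_colored_mperms: "finite (colored_mperms n m r)"
proof -
  let ?L = "SIGMA k:{1..n}. {1..r k}"
  have "colored_mperms n m r \<subseteq> {w. set w \<subseteq> ?L \<and> length w = (\<Sum>k=1..n. m k)}"
  proof safe
    fix w assume w: "w \<in> colored_mperms n m r"
    show "length w = (\<Sum>k=1..n. m k)"
    proof -
      have "set (map fst w) \<subseteq> {1..n}" using w by (force simp: colored_mperms_def)
      then have "length (map fst w) = (\<Sum>k=1..n. count_list (map fst w) k)"
        by (metis finite_atLeastAtMost sum_count_set)
      then show ?thesis using w by (simp add: colored_mperms_def)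
    qed
  qed (auto simp: colored_mperms_def)
  then show ?thesis by (rule finite_subset) (auto intro: finite_lists_length_eq)
qed

definition color_less :: "nat \<times> nat \<Rightarrow> nat \<times> nat \<Rightarrow> bool" where
  "color_less x y \<longleftrightarrow> snd x < snd y \<or> snd x = snd y \<and> fst x < fst y"

text \<open>The \<open>j\<close>-th letter, \<open>1 \<le> j \<le> length w + 1\<close>, of \<open>w\<close> with the letter \<open>n + 1\<close> of color \<open>1\<close>
  appended.\<close>

definition ext_letter :: "nat \<Rightarrow> (nat \<times> nat) list \<Rightarrow> nat \<Rightarrow> nat \<times> nat" where
  "ext_letter n w j = (w @ [(n + 1, 1)]) ! (j - 1)"

definition DES :: "nat \<Rightarrow> (nat \<times> nat) list \<Rightarrow> nat set" where
  "DES n w = {j \<in> {1..length w}. color_less (ext_letter n w (j + 1)) (ext_letter n w j)}"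

definition color_count :: "nat \<Rightarrow> (nat \<times> nat) list \<Rightarrow> nat" where
  "color_count p w = count_list (map snd w) p"

definition z_tail ::
  "nat \<Rightarrow> (nat \<Rightarrow> nat) \<Rightarrow> (nat \<times> nat) list \<Rightarrow> nat \<Rightarrow> (var, 'a :: comm_ring_1) mps" where
  "z_tail n r w i =
     (\<Prod>j=i..length w. case ext_letter n w j of (k, c) \<Rightarrow> zvar k c ^ r k) * zlast"

definition weak_compositions :: "nat \<Rightarrow> nat \<Rightarrow> (nat \<Rightarrow> nat) set" where
  "weak_compositions N s = {i \<in> {1..s} \<rightarrow>\<^sub>E UNIV. (\<Sum>l=1..s. i l) = N}"

lemma finite_weak_compositions: "finite (weak_compositions N s)"
proof (rule finite_subset)
  show "weak_compositions N s \<subseteq> {1..s} \<rightarrow>\<^sub>E {..N}"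
    by (auto simp: weak_compositions_def PiE_def Pi_def intro: member_le_sum)
qed (auto intro: finite_PiE)

end

theory Submission
  imports Defs "HOL-Library.Product_Lexorder"
begin

text \<open>
  Expand the fraction of a word \<open>w\<close> geometrically. The coefficient of \<open>zlast ^ t\<close> becomes a sum over
  the sequences \<open>f\<^sub>1 \<le> \<dots> \<le> f\<^sub>m \<le> t\<close> that increase strictly at the descents of \<open>w\<close>, i.e. over the
  ways to make the triples (value, color, letter) along \<open>w\<close> lexicographically sorted, with the
  appended letter acting as the bound \<open>(t, 1, n + 1)\<close>. Sorted lists of triples are multisets, so the
  sum over all words factors over the letters \<open>k\<close> and their colors \<open>l\<close>. For fixed \<open>k\<close> and \<open>l\<close> the
  values form a multiset in \<open>{0..t}\<close> if \<open>l = 1\<close> and in \<open>{0..<t}\<close> otherwise, and such multisets of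
  given size are counted by a Gaussian binomial coefficient.
\<close>

section \<open>Limits of power series\<close>

lemma mps_eventually_nhds_pair:
  "\<forall>\<^sub>F x in nhds a \<times>\<^sub>F nhds b.
     mps_coeff (fst x) A = mps_coeff a A \<and> mps_coeff (snd x) B = mps_coeff b B"
proof -
  have "(fst \<longlongrightarrow> a) (nhds a \<times>\<^sub>F nhds b)" "(snd \<longlongrightarrow> b) (nhds a \<times>\<^sub>F nhds b)"
    by (auto simp: filterlim_def filtermap_fst_prod_filter filtermap_snd_prod_filter)
  then show ?thesis
    unfolding mps_tendsto_iff by (intro eventually_conj) blast+
qed

text \<open>Limits of series may now be added, as \<open>tendsto_add\<close> and
  \<open>sums_sum\<close> require.\<close>

instance mps :: (type, comm_ring_1) topological_comm_monoid_add
proof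
  fix a b :: "('a, 'b) mps"
  show "((\<lambda>x. fst x + snd x) \<longlongrightarrow> a + b) (nhds a \<times>\<^sub>F nhds b)"
    unfolding mps_tendsto_iff plus_mps.rep_eq
  proof
    fix M
    show "\<forall>\<^sub>F x in nhds a \<times>\<^sub>F nhds b.
        mps_coeff (fst x) M + mps_coeff (snd x) M = mps_coeff a M + mps_coeff b M"
      using mps_eventually_nhds_pair[where A = M and B = M] by (rule eventually_mono) simp
  qed
qed

text \<open>A monomial has only finitely many splittings, so finitely many coefficients of the
  factors decide a coefficient of the product.\<close>

instance mps :: (type, comm_ring_1) topological_semigroup_mult
proof
  fix a b :: "('a, 'b) mps"
  let ?F = "nhds a \<times>\<^sub>F nhds b"
  show "((\<lambda>x. fst x * snd x) \<longlongrightarrow> a * b) ?F"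
    unfolding mps_tendsto_iff
  proof
    fix M :: "'a multiset"
    have "\<forall>\<^sub>F x in ?F. \<forall>p\<in>{(A, B). A + B = M}.
        mps_coeff (fst x) (fst p) = mps_coeff a (fst p) \<and> mps_coeff (snd x) (snd p) = mps_coeff b (snd p)"
      using mps_eventually_nhds_pair by (intro eventually_ball_finite finite_multiset_splits) blast
    then show "\<forall>\<^sub>F x in ?F. mps_coeff (fst x * snd x) M = mps_coeff (a * b) M"
      unfolding times_mps.rep_eq by (rule eventually_mono) (auto intro!: sum.cong)
  qed
qed

text \<open>The power \<open>z ^ N\<close> has no monomial of degree below \<open>N\<close>, and
  multiplication by \<open>c N\<close> creates none, so every coefficient is eventually
  zero.\<close>

lemma mps_power_mult_tendsto_0:
  fixes z :: "('v, 'a :: comm_ring_1) mps"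
  assumes "mps_coeff z {#} = 0"
  shows "(\<lambda>N. z ^ N * c N) \<longlonglongrightarrow> 0"
  unfolding mps_tendsto_iff
proof
  fix M :: "'v multiset"
  have "mps_coeff (z ^ N * c N) M = 0" if "size M < N" for N
    unfolding times_mps.rep_eq using that
    by (intro sum.neutral) (auto simp: mps_coeff_power_eq_0[OF assms])
  then show "\<forall>\<^sub>F N in sequentially. mps_coeff (z ^ N * c N) M = mps_coeff 0 M"
    by (auto simp: eventually_sequentially zero_mps.rep_eq intro!: exI[of _ "Suc (size M)"])
qed

lemma mps_coeff_mult_empty: "mps_coeff g {#} = 0 \<Longrightarrow> mps_coeff (f * g) {#} = 0"
  by (auto simp: times_mps.rep_eq intro: sum.neutral)

lemma mps_divide_eqI:
  fixes f g h :: "('v, 'a :: comm_ring_1) mps"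
  assumes "g dvd 1" "h * g = f"
  shows "f / g = h"
  using mps_mult_inverse[OF assms(1)] assms(2)
  by (metis divide_mps_def mult.assoc mult.right_neutral)

text \<open>In generating functions the recurrence reads \<open>L = X * z * L + B\<close>.
  Convergence comes from telescoping the partial sums after multiplication by the unit
  \<open>1 - X * z\<close>.\<close>

lemma mps_sums_recurrence:
  fixes z X :: "('v, 'a :: comm_ring_1) mps"
  assumes z: "mps_coeff z {#} = 0"
    and a: "a 0 = b 0" "\<And>t. a (Suc t) = X * a t + b (Suc t)"
    and b: "(\<lambda>t. z ^ t * b t) sums B"
  shows "\<exists>L. (\<lambda>t. z ^ t * a t) sums L \<and> L * (1 - X * z) = B"
proof -
  have "mps_coeff (X * z) {#} = 0" using z by (rule mps_coeff_mult_empty)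
  from mps_one_minus_unit[OF this] obtain u where u: "(1 - X * z) * u = 1" by (metis dvdE)
  have cancel: "u * ((1 - X * z) * f) = f" for f
    using arg_cong[OF u, of "\<lambda>v. v * f"] by (simp only: mult_1 mult.left_commute mult.assoc)
  \<comment> \<open>The boundary term left over by telescoping; for \<open>N = 0\<close> the sum is
    empty and nothing is left over.\<close>
  define c where "c N = (case N of 0 \<Rightarrow> 0 | Suc t \<Rightarrow> - (X * a t))" for N
  have partial: "(1 - X * z) * (\<Sum>t<N. z ^ t * a t) = (\<Sum>t<N. z ^ t * b t) + z ^ N * c N" for N
  proof (induction N)
    case (Suc N)
    have "z ^ N * (a N - b N) = - (z ^ N * c N)"
      by (cases N) (simp_all add: c_def a algebra_simps)
    then have "(1 - X * z) * (z ^ N * a N) = z ^ N * b N - z ^ N * c N + z ^ Suc N * c (Suc N)"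
      by (simp add: c_def algebra_simps)
    with Suc show ?case by (simp only: sum.lessThan_Suc distrib_left) simp
  qed (simp add: c_def)
  have "(\<Sum>t<N. z ^ t * a t) = u * ((\<Sum>t<N. z ^ t * b t) + z ^ N * c N)" for N
    unfolding partial[symmetric] cancel ..
  moreover have "(\<lambda>N. u * ((\<Sum>t<N. z ^ t * b t) + z ^ N * c N)) \<longlonglongrightarrow> u * (B + 0)"
    using b unfolding sums_def
    by (intro tendsto_mult tendsto_add tendsto_const mps_power_mult_tendsto_0 z)
  ultimately have "(\<lambda>t. z ^ t * a t) sums (u * B)" by (simp add: sums_def)
  moreover have "u * B * (1 - X * z) = B"
    using cancel[of B] by (simp only: mult.assoc mult.commute[of B])
  ultimately show ?thesis by blast
qed

section \<open>Compatible sequences\<close>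

text \<open>The entries of \<open>fs\<close> are the partial sums of the exponents with which the fractions
  \<open>1 / (1 - z_tail i)\<close> are expanded. Lexicographic sortedness says that \<open>fs\<close> is weakly increasing
  and increases strictly at the descents of \<open>w\<close>.\<close>

definition compat :: "nat \<Rightarrow> 'b :: linorder \<Rightarrow> 'b list \<Rightarrow> nat list set" where
  "compat t s w = {fs. length fs = length w \<and> sorted (zip (fs @ [t]) (w @ [s]))}"

text \<open>With \<open>g\<close> the letter weight, this is the coefficient of
  \<open>zlast ^ t\<close> in the expanded fraction of a word, color variables aside: a tail passes
  its exponent on to all letters from its position on, so a letter carries the partial sum
  \<open>f\<close> and \<open>zlast\<close> the total \<open>t\<close>.\<close>

definition compat_sum ::
  "('b \<Rightarrow> 'a :: comm_ring_1) \<Rightarrow> nat \<Rightarrow> 'b :: linorder \<Rightarrow> 'b list \<Rightarrow> 'a" where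
  "compat_sum g t s w = (\<Sum>fs\<in>compat t s w. prod_list (map2 (\<lambda>f x. g x ^ f) fs w))"

lemma compat_iff:
  "fs \<in> compat t s w \<longleftrightarrow>
     length fs = length w \<and> sorted (zip fs w) \<and> (\<forall>p\<in>set (zip fs w). p \<le> (t, s))"
  by (auto simp: compat_def sorted_append simp del: less_eq_prod_simp)

lemma compat_le:
  assumes "fs \<in> compat t s w" "f \<in> set fs"
  shows "f \<le> t"
proof -
  from assms obtain x where "(f, x) \<in> set (zip fs w)"
    by (metis compat_iff in_set_impl_in_set_zip1)
  then have "(f, x) \<le> (t, s)" using assms(1) unfolding compat_iff by blast
  then show ?thesis by auto
qed

lemma finite_compat: "finite (compat t s w)"
proof (rule finite_subset)
  show "compat t s w \<subseteq> {fs. set fs \<subseteq> {..t} \<and> length fs = length w}"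
    using compat_le[of _ t s w] by (auto simp: compat_def)
qed (simp add: finite_lists_length_eq)

lemma compat_Nil: "compat t s [] = {[]}"
  by (auto simp: compat_iff)

text \<open>Adding 1 to all values, the bound included, preserves every comparison.\<close>

lemma compat_map_Suc: "map Suc fs \<in> compat (Suc t) s w \<longleftrightarrow> fs \<in> compat t s w"
proof -
  have "zip (map Suc fs @ [Suc t]) (w @ [s]) = map (map_prod Suc id) (zip (fs @ [t]) (w @ [s]))"
    using zip_map_map[of Suc "fs @ [t]" id "w @ [s]"] by (simp add: map_prod_def)
  moreover have "sorted (map (map_prod Suc id) xs) \<longleftrightarrow> sorted xs" for xs :: "(nat \<times> 'a) list"
    by (induction xs) (auto simp: less_eq_prod_def)
  ultimately show ?thesis by (simp only: compat_def) auto
qed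

text \<open>The heads of \<open>fs @ [t]\<close> and \<open>w @ [s]\<close> are the next value and
  the next letter, which are those of the bound when \<open>fs\<close> and \<open>w\<close> are
  empty.\<close>

lemma compat_Cons:
  "f # fs \<in> compat t s (x # w) \<longleftrightarrow> fs \<in> compat t s w \<and> (f, x) \<le> (hd (fs @ [t]), hd (w @ [s]))"
  (is "?l \<longleftrightarrow> ?r")
proof (cases "length fs = length w")
  case True
  then have "zip (fs @ [t]) (w @ [s]) = (hd (fs @ [t]), hd (w @ [s])) # tl (zip (fs @ [t]) (w @ [s]))"
    by (cases fs; cases w) auto
  then have "sorted (zip ((f # fs) @ [t]) ((x # w) @ [s])) \<longleftrightarrow>
      (f, x) \<le> (hd (fs @ [t]), hd (w @ [s])) \<and> sorted (zip (fs @ [t]) (w @ [s]))"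
    by (metis append_Cons sorted2 zip_Cons_Cons)
  then show ?thesis using True by (auto simp: compat_def)
qed (auto simp: compat_def)

text \<open>Values increase weakly up to \<open>t\<close>, so a positive first value makes all of
  them and \<open>t\<close> positive, and 1 can be subtracted throughout.\<close>

lemma compat_positive:
  assumes "fs \<in> compat t s w" "0 < hd (fs @ [t])"
  shows "\<exists>t' fs'. t = Suc t' \<and> fs = map Suc fs' \<and> fs' \<in> compat t' s w"
proof -
  have len: "length fs = length w" and sorted: "sorted (zip (fs @ [t]) (w @ [s]))"
    using assms(1) by (auto simp: compat_def)
  have "sorted (map fst (zip (fs @ [t]) (w @ [s])))"
    unfolding sorted_map by (rule sorted_wrt_mono_rel[OF _ sorted]) (auto simp: less_eq_prod_def)
  then have "sorted (fs @ [t])" using len by simp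
  then have pos: "\<forall>f\<in>set (fs @ [t]). 0 < f"
    using assms(2) by (cases fs) (auto simp: less_le_trans)
  then obtain t' where t': "t = Suc t'" by (cases t) auto
  have "fs = map Suc (map (\<lambda>f. f - 1) fs)"
    using pos by (simp add: map_idI)
  then show ?thesis using t' assms(1) by (metis compat_map_Suc)
qed

section \<open>Recurrences in the bound\<close>

lemma compat_0_Cons:
  "compat 0 s (x # w) = (if hd (w @ [s]) < x then {} else (#) 0 ` compat 0 s w)"
proof -
  have "fs \<in> compat 0 s (x # w) \<longleftrightarrow> \<not> hd (w @ [s]) < x \<and> (\<exists>gs\<in>compat 0 s w. fs = 0 # gs)" for fs
  proof (cases fs)
    case (Cons f gs)
    \<comment> \<open>The bound 0 forces all later values to be 0, which rules out the strict
      increase at a descent.\<close>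
    have "hd (gs @ [0]) = 0" if "gs \<in> compat 0 s w" using compat_le[OF that] by (cases gs) auto
    then show ?thesis by (auto simp: Cons compat_Cons not_less)
  qed (auto simp: compat_def)
  then show ?thesis by auto
qed

text \<open>If the first value is positive, 1 is subtracted everywhere. After a first value 0, a
  descent forces the rest to be positive, so 1 is subtracted from the rest; without a descent the
  rest is any compatible sequence.\<close>

lemma compat_Suc_Cons:
  "compat (Suc t) s (x # w) = map Suc ` compat t s (x # w) \<union>
     (#) 0 ` (if hd (w @ [s]) < x then map Suc ` compat t s w else compat (Suc t) s w)"
  (is "_ = ?A \<union> ?B")
proof (intro set_eqI iffI)
  fix fs assume fs: "fs \<in> compat (Suc t) s (x # w)"
  then obtain f gs where gs: "fs = f # gs" by (cases fs) (auto simp: compat_def)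
  show "fs \<in> ?A \<union> ?B"
  proof (cases f)
    case 0
    have "gs \<in> map Suc ` compat t s w" if "hd (w @ [s]) < x"
      using fs that compat_positive[of gs "Suc t" s w] by (auto simp: gs 0 compat_Cons)
    then show ?thesis using fs by (auto simp: gs 0 compat_Cons)
  next
    case (Suc f')
    then have "0 < hd (fs @ [Suc t])" by (simp add: gs)
    from compat_positive[OF fs this] have "fs \<in> map Suc ` compat t s (x # w)" by blast
    then show ?thesis by blast
  qed
next
  fix fs assume "fs \<in> ?A \<union> ?B"
  moreover have "hd (map Suc gs @ [Suc t]) = Suc (hd (gs @ [t]))" for gs by (cases gs) auto
  ultimately show "fs \<in> compat (Suc t) s (x # w)"
    by (auto simp: compat_map_Suc compat_Cons not_less split: if_splits)
qed

lemma prod_list_map2_Suc: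
  fixes g :: "'b \<Rightarrow> 'a :: comm_ring_1"
  assumes "length fs = length w"
  shows "prod_list (map2 (\<lambda>f x. g x ^ f) (map Suc fs) w) =
    prod_list (map g w) * prod_list (map2 (\<lambda>f x. g x ^ f) fs w)"
  using assms by (induction fs w rule: list_induct2) (auto simp: algebra_simps)

lemma sum_map_Suc_compat:
  "(\<Sum>fs\<in>map Suc ` compat t s w. prod_list (map2 (\<lambda>f x. g x ^ f) fs w)) =
    prod_list (map g w) * compat_sum g t s w"
  unfolding compat_sum_def sum_distrib_left
  by (subst sum.reindex)
     (auto simp: inj_on_def compat_def prod_list_map2_Suc intro!: sum.cong)

lemma sum_Cons_0:
  "(\<Sum>fs\<in>(#) 0 ` C. prod_list (map2 (\<lambda>f x. g x ^ f) fs (x # w))) =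
    (\<Sum>fs\<in>C. prod_list (map2 (\<lambda>f x. g x ^ f) fs w))"
  by (subst sum.reindex) (auto simp: inj_on_def)

lemma compat_sum_0_Cons:
  "compat_sum g 0 s (x # w) = (if hd (w @ [s]) < x then 0 else compat_sum g 0 s w)"
  unfolding compat_sum_def by (simp add: compat_0_Cons sum_Cons_0 del: list.map zip_Cons_Cons)

lemma compat_sum_Suc_Cons:
  "compat_sum g (Suc t) s (x # w) = prod_list (map g (x # w)) * compat_sum g t s (x # w) +
     (if hd (w @ [s]) < x then prod_list (map g w) * compat_sum g t s w else compat_sum g (Suc t) s w)"
proof -
  let ?C = "if hd (w @ [s]) < x then map Suc ` compat t s w else compat (Suc t) s w"
  let ?wt = "\<lambda>w fs. prod_list (map2 (\<lambda>f x. g x ^ f) fs w)"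
  \<comment> \<open>The first value is positive in one set and 0 in the other.\<close>
  have "map Suc ` compat t s (x # w) \<inter> (#) 0 ` ?C = {}" by auto
  then have "compat_sum g (Suc t) s (x # w) =
      sum (?wt (x # w)) (map Suc ` compat t s (x # w)) + sum (?wt (x # w)) ((#) 0 ` ?C)"
    unfolding compat_sum_def compat_Suc_Cons
    by (intro sum.union_disjoint) (auto intro: finite_compat)
  also have "sum (?wt (x # w)) ((#) 0 ` ?C) = sum (?wt w) ?C" by (rule sum_Cons_0)
  also have "\<dots> = (if hd (w @ [s]) < x then prod_list (map g w) * compat_sum g t s w
      else compat_sum g (Suc t) s w)"
    by (auto simp only: sum_map_Suc_compat compat_sum_def split: if_splits)
  finally show ?thesis by (simp only: sum_map_Suc_compat)
qed

text \<open>By induction on \<open>w\<close>, \<open>mps_sums_recurrence\<close> adds one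
  denominator factor per letter, and the shift of \<open>t\<close> at a descent adds the numerator
  factor \<open>T w\<close>. Clearing the denominators keeps divisions out of the induction.\<close>

lemma compat_sum_sums:
  fixes z :: "('v, 'a :: comm_ring_1) mps" and g :: "'b :: linorder \<Rightarrow> ('v, 'a) mps"
  assumes z: "mps_coeff z {#} = 0"
  defines "T \<equiv> \<lambda>w. prod_list (map g w) * z"
  shows "\<exists>L. (\<lambda>t. z ^ t * compat_sum g t s w) sums L \<and>
    L * (\<Prod>i\<le>length w. 1 - T (drop i w)) =
      (\<Prod>i<length w. if (w @ [s]) ! Suc i < w ! i then T (drop (Suc i) w) else 1)"
proof (induction w)
  case Nil
  \<comment> \<open>For the empty word all coefficients are 1, which solves the recurrence with
    \<open>X = 1\<close> and the indicator of \<open>t = 0\<close> as inhomogeneous part.\<close>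
  have "(\<lambda>t. z ^ t * (if t = 0 then 1 else 0)) sums 1"
    using sums_If_finite[of "\<lambda>t. t = 0" "\<lambda>t. z ^ t"] by (simp add: if_distrib cong: if_cong)
  from mps_sums_recurrence[OF z _ _ this, of "\<lambda>_. 1" 1]
  show ?case by (auto simp: compat_sum_def compat_Nil T_def)
next
  case (Cons x w)
  let ?N = "\<lambda>w. \<Prod>i<length w. if (w @ [s]) ! Suc i < w ! i then T (drop (Suc i) w) else 1"
  let ?D = "\<lambda>w. \<Prod>i\<le>length w. 1 - T (drop i w)"
  let ?des = "hd (w @ [s]) < x"
  from Cons obtain L where L: "(\<lambda>t. z ^ t * compat_sum g t s w) sums L" "L * ?D w = ?N w" by blast
  \<comment> \<open>The inhomogeneous part of the recurrence for \<open>x # w\<close>. At a descent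
    it is delayed by one step, since the values on \<open>w\<close> must then be positive; hence the
    0 at \<open>t = 0\<close>.\<close>
  define b where "b t = (if ?des then (case t of 0 \<Rightarrow> 0 | Suc t \<Rightarrow> prod_list (map g w) * compat_sum g t s w)
    else compat_sum g t s w)" for t
  have b: "(\<lambda>t. z ^ t * b t) sums ((if ?des then T w else 1) * L)"
  proof (cases ?des)
    case True
    have "(\<Sum>t<Suc N. z ^ t * b t) = T w * (\<Sum>t<N. z ^ t * compat_sum g t s w)" for N
      unfolding sum.lessThan_Suc_shift using True
      by (simp add: b_def T_def sum_distrib_left algebra_simps)
    moreover have "(\<lambda>N. T w * (\<Sum>t<N. z ^ t * compat_sum g t s w)) \<longlonglongrightarrow> T w * L"
      using L(1) unfolding sums_def by (intro tendsto_mult tendsto_const)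
    ultimately have "(\<lambda>N. \<Sum>t<Suc N. z ^ t * b t) \<longlonglongrightarrow> T w * L" by simp
    from filterlim_sequentially_Suc[THEN iffD1, OF this]
    show ?thesis using True by (simp add: sums_def)
  qed (use L in \<open>simp add: b_def\<close>)
  have "\<exists>K. (\<lambda>t. z ^ t * compat_sum g t s (x # w)) sums K \<and>
      K * (1 - prod_list (map g (x # w)) * z) = (if ?des then T w else 1) * L"
    by (rule mps_sums_recurrence[OF z _ _ b])
       (simp_all add: b_def compat_sum_0_Cons compat_sum_Suc_Cons)
  then obtain K where K: "(\<lambda>t. z ^ t * compat_sum g t s (x # w)) sums K"
    "K * (1 - T (x # w)) = (if ?des then T w else 1) * L" unfolding T_def by blast
  have "?D (x # w) = (1 - T (x # w)) * ?D w"
    by (simp only: list.size add_Suc_right add_0_right prod.atMost_Suc_shift) simp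
  moreover have "?N (x # w) = (if ?des then T w else 1) * ?N w"
    by (simp only: list.size add_Suc_right add_0_right prod.lessThan_Suc_shift)
       (cases w; simp cong: if_cong)
  ultimately have "K * ?D (x # w) = ?N (x # w)"
    using K(2) L(2) by (simp only: flip: mult.assoc) (simp add: mult.assoc)
  then show ?case using K(1) by blast
qed

section \<open>Complete homogeneous sums\<close>

definition msets :: "nat \<Rightarrow> 'b set \<Rightarrow> 'b multiset set" where
  "msets N S = {A. set_mset A \<subseteq> S \<and> size A = N}"

text \<open>The complete homogeneous symmetric polynomial of degree \<open>N\<close>, evaluated at
  the family \<open>g\<close> on \<open>S\<close>.\<close>

definition hom_sum :: "nat \<Rightarrow> 'b set \<Rightarrow> ('b \<Rightarrow> 'a :: comm_ring_1) \<Rightarrow> 'a" where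
  "hom_sum N S g = (\<Sum>A\<in>msets N S. \<Prod>a\<in>#A. g a)"

lemma finite_msets:
  assumes "finite S"
  shows "finite (msets N S)"
proof (rule finite_subset)
  show "msets N S \<subseteq> mset ` {xs. set xs \<subseteq> S \<and> length xs = N}"
  proof
    fix A assume A: "A \<in> msets N S"
    obtain xs where "A = mset xs" by (metis ex_mset)
    then show "A \<in> mset ` {xs. set xs \<subseteq> S \<and> length xs = N}" using A by (auto simp: msets_def)
  qed
qed (use assms in \<open>simp add: finite_lists_length_eq\<close>)

lemma hom_sum_0: "hom_sum 0 S g = 1"
proof -
  have "msets 0 S = {{#}}" by (auto simp: msets_def)
  then show ?thesis by (simp add: hom_sum_def)
qed

lemma hom_sum_Suc_empty: "hom_sum (Suc N) ({} :: 'b set) g = 0"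
proof -
  have "msets (Suc N) ({} :: 'b set) = {}" by (auto simp: msets_def)
  then show ?thesis unfolding hom_sum_def by (simp only: sum.empty)
qed

text \<open>A multiset either avoids \<open>a\<close> or contains it, and then one copy of
  \<open>a\<close> is removed.\<close>

lemma hom_sum_Suc_insert:
  assumes "finite S" "a \<notin> S"
  shows "hom_sum (Suc N) (insert a S) g = hom_sum (Suc N) S g + g a * hom_sum N (insert a S) g"
proof -
  have "A \<in> msets (Suc N) (insert a S) \<longleftrightarrow> A \<in> msets (Suc N) S \<union> add_mset a ` msets N (insert a S)" for A
  proof (cases "a \<in># A")
    case True
    then obtain B where "A = add_mset a B" by (metis insert_DiffM)
    then show ?thesis using assms by (auto simp: msets_def image_iff)
  qed (auto simp: msets_def)
  then have "msets (Suc N) (insert a S) = msets (Suc N) S \<union> add_mset a ` msets N (insert a S)"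
    by blast
  moreover have "msets (Suc N) S \<inter> add_mset a ` msets N (insert a S) = {}"
    using assms by (auto simp: msets_def)
  moreover have "(\<Sum>A\<in>add_mset a ` msets N (insert a S). \<Prod>b\<in>#A. g b) = g a * hom_sum N (insert a S) g"
    by (subst sum.reindex) (simp_all add: inj_on_def hom_sum_def sum_distrib_left)
  ultimately show ?thesis
    using assms by (simp add: hom_sum_def sum.union_disjoint finite_msets)
qed

section \<open>Splitting multisets into classes\<close>

lemma mset_sum_filter_classes:
  assumes "finite I" "\<kappa> ` set_mset A \<subseteq> I"
  shows "(\<Sum>i\<in>I. {#a \<in># A. \<kappa> a = i#}) = A"
proof (rule multiset_eqI)
  fix a
  have "count (\<Sum>i\<in>I. {#a \<in># A. \<kappa> a = i#}) a = (\<Sum>i\<in>I. if i = \<kappa> a then count A a else 0)"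
    unfolding count_sum by (rule sum.cong) auto
  also have "\<dots> = count A a"
    using assms by (auto simp: not_in_iff[symmetric])
  finally show "count (\<Sum>i\<in>I. {#a \<in># A. \<kappa> a = i#}) a = count A a" .
qed

text \<open>Together with \<open>mset_sum_filter_classes\<close> this makes filtering by class and
  summing mutually inverse.\<close>

lemma filter_mset_sum_classes:
  assumes "finite I" "i \<in> I" "\<And>j. j \<in> I \<Longrightarrow> \<kappa> ` set_mset (F j) \<subseteq> {j}"
  shows "{#a \<in># (\<Sum>j\<in>I. F j). \<kappa> a = i#} = F i"
proof -
  have "{#a \<in># (\<Sum>j\<in>J. F j). \<kappa> a = i#} = (if i \<in> J then F i else {#})" if "finite J" "J \<subseteq> I" for J
    using that
  proof (induction J rule: finite_induct)
    case (insert j J)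
    have "{#a \<in># F j. \<kappa> a = i#} = (if j = i then F j else {#})"
      using assms(3)[of j] insert.prems by (auto simp: filter_mset_eq_conv filter_mset_eq_mempty_iff)
    then show ?case using insert by auto
  qed simp
  then show ?thesis using assms by simp
qed

text \<open>Expanding the product chooses one multiset per class; the choices correspond to their
  sum, from which filtering by \<open>\<kappa>\<close> recovers them.\<close>

lemma prod_hom_sum:
  fixes g :: "'b \<Rightarrow> 'a :: comm_ring_1"
  assumes "finite I" "finite S" "\<kappa> ` S \<subseteq> I"
  shows "(\<Prod>i\<in>I. hom_sum (s i) {a \<in> S. \<kappa> a = i} g) =
    (\<Sum>A | set_mset A \<subseteq> S \<and> (\<forall>i\<in>I. size {#a \<in># A. \<kappa> a = i#} = s i). \<Prod>a\<in>#A. g a)"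
proof -
  let ?M = "\<lambda>i. msets (s i) {a \<in> S. \<kappa> a = i}"
  have classes: "\<kappa> ` set_mset (F i) \<subseteq> {i}" if "F \<in> Pi\<^sub>E I ?M" "i \<in> I" for F i
    using that by (force simp: msets_def PiE_def Pi_def)
  have "(\<Prod>i\<in>I. hom_sum (s i) {a \<in> S. \<kappa> a = i} g) =
      (\<Sum>F\<in>Pi\<^sub>E I ?M. \<Prod>i\<in>I. \<Prod>a\<in>#F i. g a)"
    unfolding hom_sum_def using assms by (intro prod_sum_PiE finite_msets) auto
  also have "\<dots> = (\<Sum>A | set_mset A \<subseteq> S \<and> (\<forall>i\<in>I. size {#a \<in># A. \<kappa> a = i#} = s i). \<Prod>a\<in>#A. g a)"
  proof (rule sum.reindex_bij_witness[of _ "\<lambda>A. \<lambda>i\<in>I. {#a \<in># A. \<kappa> a = i#}" "\<lambda>F. \<Sum>i\<in>I. F i"])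
    fix F assume F: "F \<in> Pi\<^sub>E I ?M"
    have filter: "{#a \<in># (\<Sum>i\<in>I. F i). \<kappa> a = i#} = F i" if "i \<in> I" for i
      using assms(1) that classes[OF F] by (rule filter_mset_sum_classes)
    show "(\<lambda>i\<in>I. {#a \<in># (\<Sum>i\<in>I. F i). \<kappa> a = i#}) = F"
      using F by (auto simp: filter PiE_def extensional_def restrict_def)
    have "a \<in> S" if "a \<in># F i" "i \<in> I" for a i
      using F that by (auto simp: msets_def PiE_def Pi_def)
    moreover have "size (F i) = s i" if "i \<in> I" for i
      using F that by (auto simp: msets_def PiE_def Pi_def)
    ultimately show "(\<Sum>i\<in>I. F i) \<in>
        {A. set_mset A \<subseteq> S \<and> (\<forall>i\<in>I. size {#a \<in># A. \<kappa> a = i#} = s i)}"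
      using assms(1) by (auto simp: filter set_mset_sum)
    show "(\<Prod>a\<in>#(\<Sum>i\<in>I. F i). g a) = (\<Prod>i\<in>I. \<Prod>a\<in>#F i. g a)"
      using assms(1) by (induction I rule: finite_induct) auto
  next
    fix A assume A: "A \<in> {A. set_mset A \<subseteq> S \<and> (\<forall>i\<in>I. size {#a \<in># A. \<kappa> a = i#} = s i)}"
    then have "\<kappa> ` set_mset A \<subseteq> I" using assms(3) by auto
    from mset_sum_filter_classes[OF assms(1) this]
    show "(\<Sum>i\<in>I. (\<lambda>i\<in>I. {#a \<in># A. \<kappa> a = i#}) i) = A" by simp
    show "(\<lambda>i\<in>I. {#a \<in># A. \<kappa> a = i#}) \<in> Pi\<^sub>E I ?M"
      using A by (auto simp: msets_def)
  qed
  finally show ?thesis .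
qed

text \<open>Multisets are grouped by the sizes of their classes, and each group factors by
  \<open>prod_hom_sum\<close>.\<close>

lemma hom_sum_weak_compositions:
  fixes g :: "'b \<Rightarrow> 'a :: comm_ring_1"
  assumes "finite S" "\<kappa> ` S \<subseteq> {1..s}"
  shows "hom_sum N S g =
    (\<Sum>i\<in>weak_compositions N s. \<Prod>l=1..s. hom_sum (i l) {a \<in> S. \<kappa> a = l} g)"
proof -
  \<comment> \<open>The restriction puts the size vector into \<open>weak_compositions\<close>,
    which consists of extensional functions.\<close>
  let ?sz = "\<lambda>A. \<lambda>l\<in>{1..s}. size {#a \<in># A. \<kappa> a = l#}"
  have total: "(\<Sum>l=1..s. size {#a \<in># A. \<kappa> a = l#}) = size A" if "set_mset A \<subseteq> S" for A
  proof -
    have "\<kappa> ` set_mset A \<subseteq> {1..s}" using that assms(2) by auto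
    from mset_sum_filter_classes[OF _ this] show ?thesis by (simp flip: size_multiset_sum)
  qed
  have "hom_sum N S g =
      (\<Sum>i\<in>weak_compositions N s. \<Sum>A | A \<in> msets N S \<and> ?sz A = i. \<Prod>a\<in>#A. g a)"
    unfolding hom_sum_def
  proof (rule sum.group[symmetric])
    show "?sz ` msets N S \<subseteq> weak_compositions N s"
      using total by (auto simp: weak_compositions_def msets_def)
  qed (simp_all add: finite_msets assms finite_weak_compositions)
  also have "\<dots> = (\<Sum>i\<in>weak_compositions N s. \<Prod>l=1..s. hom_sum (i l) {a \<in> S. \<kappa> a = l} g)"
  proof (rule sum.cong[OF refl])
    fix i assume i: "i \<in> weak_compositions N s"
    have "?sz A = i \<longleftrightarrow> (\<forall>l\<in>{1..s}. size {#a \<in># A. \<kappa> a = l#} = i l)" for A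
      using i by (auto simp: weak_compositions_def PiE_def extensional_def fun_eq_iff restrict_def)
    moreover have "size A = N" if "set_mset A \<subseteq> S" "\<forall>l\<in>{1..s}. size {#a \<in># A. \<kappa> a = l#} = i l" for A
      using total[OF that(1)] that(2) i by (simp add: weak_compositions_def)
    ultimately have "{A. A \<in> msets N S \<and> ?sz A = i} =
        {A. set_mset A \<subseteq> S \<and> (\<forall>l\<in>{1..s}. size {#a \<in># A. \<kappa> a = l#} = i l)}"
      unfolding msets_def by blast
    then show "(\<Sum>A | A \<in> msets N S \<and> ?sz A = i. \<Prod>a\<in>#A. g a) =
        (\<Prod>l=1..s. hom_sum (i l) {a \<in> S. \<kappa> a = l} g)"
      using assms by (subst prod_hom_sum) auto
  qed
  finally show ?thesis .
qed

section \<open>Gaussian binomial coefficients\<close>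

lemma mps_dvd_one_prod:
  fixes f :: "'i \<Rightarrow> ('v, 'a :: comm_ring_1) mps"
  assumes "\<And>i. i \<in> I \<Longrightarrow> f i dvd 1"
  shows "prod f I dvd 1"
  using assms by (induction I rule: infinite_finite_induct) (auto intro: mult_dvd_mono[of _ 1 _ 1, simplified])

text \<open>The principal specialization of the complete homogeneous polynomial, with denominators
  cleared. The induction on \<open>U\<close> and then on \<open>N\<close> follows
  \<open>hom_sum_Suc_insert\<close>, each of whose terms lowers one of the two.\<close>

lemma hom_sum_geometric:
  fixes q y :: "'a :: comm_ring_1"
  assumes "inj \<phi>" "\<And>f. g (\<phi> f) = q ^ f * y"
  shows "hom_sum N (\<phi> ` {..<U}) g * (\<Prod>i=1..N. 1 - q ^ i) = (\<Prod>i<N. 1 - q ^ (U + i)) * y ^ N"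
proof (induction U arbitrary: N)
  case 0
  \<comment> \<open>For positive \<open>N\<close> the right side contains the factor
    \<open>1 - q ^ 0 = 0\<close>.\<close>
  show ?case
    by (cases N) (simp_all add: hom_sum_0 hom_sum_Suc_empty prod.lessThan_Suc_shift del: prod.lessThan_Suc)
next
  case (Suc U)
  note IH_U = Suc.IH
  have set: "\<phi> ` {..<Suc U} = insert (\<phi> U) (\<phi> ` {..<U})" by (auto simp: lessThan_Suc)
  show ?case
  proof (induction N)
    case (Suc N)
    let ?D = "\<lambda>N. \<Prod>i=1..N. 1 - q ^ i" and ?P = "\<Prod>i<N. 1 - q ^ (Suc U + i)"
    have "hom_sum (Suc N) (\<phi> ` {..<Suc U}) g =
        hom_sum (Suc N) (\<phi> ` {..<U}) g + q ^ U * y * hom_sum N (\<phi> ` {..<Suc U}) g"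
      unfolding set using assms
      by (subst hom_sum_Suc_insert) (auto simp: inj_eq)
    then have "hom_sum (Suc N) (\<phi> ` {..<Suc U}) g * ?D (Suc N) =
        hom_sum (Suc N) (\<phi> ` {..<U}) g * ?D (Suc N) +
        q ^ U * y * (1 - q ^ Suc N) * (hom_sum N (\<phi> ` {..<Suc U}) g * ?D N)"
      by (simp add: algebra_simps)
    also have "\<dots> = (1 - q ^ U) * ?P * y ^ Suc N + q ^ U * y * (1 - q ^ Suc N) * (?P * y ^ N)"
      unfolding Suc.IH IH_U by (simp only: prod.lessThan_Suc_shift) simp
    \<comment> \<open>Uses
      \<open>(1 - q ^ U) + q ^ U * (1 - q ^ Suc N) = 1 - q ^ (Suc U + N)\<close>.\<close>
    also have "\<dots> = ?P * (1 - q ^ (Suc U + N)) * y ^ Suc N"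
      by (simp add: algebra_simps power_add)
    finally show ?case by simp
  qed (simp add: hom_sum_0)
qed

lemma mps_prod_divide:
  fixes f g :: "'i \<Rightarrow> ('v, 'a :: comm_ring_1) mps"
  assumes "\<And>i. i \<in> I \<Longrightarrow> g i dvd 1"
  shows "(\<Prod>i\<in>I. f i / g i) * prod g I = prod f I"
proof -
  have "f i / g i * g i = f i" if "i \<in> I" for i
    using mps_mult_inverse[OF assms[OF that]] by (simp add: divide_mps_def mult.assoc mult.commute[of "inverse (g i)"])
  then show ?thesis by (simp flip: prod.distrib)
qed

text \<open>The number \<open>U\<close> of admissible values is one more than the usual upper entry minus \<open>N\<close>, so that
  \<open>U = 0\<close> is the case of the upper entry \<open>N - 1\<close>.\<close>

lemma gauss_binomial_hom_sum:
  fixes q y :: "('v, 'a :: comm_ring_1) mps"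
  assumes "inj \<phi>" "\<And>f. g (\<phi> f) = q ^ f * y" "mps_coeff q {#} = 0"
  shows "gauss_binomial (int U - 1 + int N) N q * y ^ N = hom_sum N (\<phi> ` {..<U}) g"
proof -
  let ?D = "\<Prod>i=1..N. 1 - q ^ i"
  have unit: "1 - q ^ i dvd 1" if "i \<in> {1..N}" for i
    using that assms(3) by (intro mps_one_minus_unit mps_coeff_power_eq_0) auto
  have "gauss_binomial (int U - 1 + int N) N q * ?D =
      (\<Prod>i=1..N. 1 - q ^ nat (int U - 1 + int N - int N + int i))"
    unfolding gauss_binomial_def by (rule mps_prod_divide[OF unit])
  also have "\<dots> = (\<Prod>i<N. 1 - q ^ (U + i))"
    by (rule prod.reindex_bij_witness[of _ Suc "\<lambda>i. i - 1"])
       (auto simp: nat_diff_distrib' intro!: arg_cong[of _ _ "\<lambda>k. q ^ k"])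
  finally have eq: "gauss_binomial (int U - 1 + int N) N q * y ^ N * ?D = hom_sum N (\<phi> ` {..<U}) g * ?D"
    using hom_sum_geometric[OF assms(1,2), of N U] by (simp add: mult_ac)
  \<comment> \<open>There may be zero divisors, so \<open>?D\<close> is cancelled by means of its
    inverse.\<close>
  have "?D dvd 1" using unit by (rule mps_dvd_one_prod)
  then obtain u where u: "1 = ?D * u" by (rule dvdE)
  from arg_cong[OF eq, of "\<lambda>f. f * u"] show ?thesis
    by (simp only: mult.assoc u[symmetric] mult_1_right)
qed

section \<open>Colored words and multisets of triples\<close>

text \<open>The lexicographic order on pairs (color, letter) is the color ordering, so words are
  transported along \<^const>\<open>prod.swap\<close>.\<close>

lemma color_less_iff: "color_less x y \<longleftrightarrow> prod.swap x < prod.swap y"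
  by (auto simp: color_less_def less_prod_def' prod.swap_def)

text \<open>The pair is in the order (color, letter), matching words mapped by
  \<open>prod.swap\<close>.\<close>

definition letter_weight :: "(nat \<Rightarrow> nat) \<Rightarrow> nat \<times> nat \<Rightarrow> (var, 'a :: comm_ring_1) mps" where
  "letter_weight r = (\<lambda>(c, k). zvar k c ^ r k)"

definition triple_weight :: "(nat \<Rightarrow> nat) \<Rightarrow> nat \<times> nat \<times> nat \<Rightarrow> (var, 'a :: comm_ring_1) mps" where
  "triple_weight r = (\<lambda>(f, c, k). letter_weight r (c, k) ^ f * yvar c)"

definition triples :: "nat \<Rightarrow> (nat \<Rightarrow> nat) \<Rightarrow> nat \<Rightarrow> (nat \<times> nat \<times> nat) set" where
  "triples n r t = {(f, c, k). k \<in> {1..n} \<and> c \<in> {1..r k} \<and> (f, c, k) \<le> (t, 1, n + 1)}"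

lemma finite_triples: "finite (triples n r t)"
proof (rule finite_subset)
  show "triples n r t \<subseteq> (\<lambda>(f, k, c). (f, c, k)) ` ({..t} \<times> (SIGMA k:{1..n}. {1..r k}))"
    by (force simp: triples_def image_iff)
qed auto

text \<open>The bounding letter \<open>(1, n + 1)\<close> lies above all letters of color 1 and
  below all others, so the value \<open>t\<close> is allowed for color 1 only.\<close>

lemma triples_class:
  assumes "k \<in> {1..n}" "l \<in> {1..r k}"
  shows "{a \<in> {a \<in> triples n r t. snd (snd a) = k}. fst (snd a) = l} =
    (\<lambda>f. (f, l, k)) ` {..<if l = 1 then Suc t else t}"
  using assms by (auto simp: triples_def)

lemma length_colored_mperm:
  assumes "w \<in> colored_mperms n m r"
  shows "length w = (\<Sum>k=1..n. m k)"
proof -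
  have "set (map fst w) \<subseteq> {1..n}" using assms by (force simp: colored_mperms_def)
  then have "length (map fst w) = (\<Sum>k=1..n. count_list (map fst w) k)"
    by (metis finite_atLeastAtMost sum_count_set)
  then show ?thesis using assms by (simp add: colored_mperms_def)
qed

lemma size_filter_zip:
  "length fs = length w \<Longrightarrow>
     size {#a \<in># mset (zip fs (map prod.swap w)). snd (snd a) = k#} = count_list (map fst w) k"
  by (induction fs w rule: list_induct2) auto

lemma prod_triple_weight_zip:
  "length fs = length w \<Longrightarrow>
     (\<Prod>a\<in>#mset (zip fs (map prod.swap w)). triple_weight r a) =
       prod_list (map (\<lambda>x. yvar (snd x)) w) *
       prod_list (map2 (\<lambda>f x. letter_weight r x ^ f) fs (map prod.swap w))"
  by (induction fs w rule: list_induct2) (auto simp: triple_weight_def algebra_simps)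

text \<open>Compatibility says exactly that the list of triples along \<open>w\<close> is sorted and
  bounded. A multiset has one sorted arrangement, so it determines both \<open>w\<close> and
  \<open>fs\<close>.\<close>

lemma sum_colored_mperms_compat:
  "(\<Sum>w\<in>colored_mperms n m r. prod_list (map (\<lambda>x. yvar (snd x)) w) *
      compat_sum (letter_weight r) t (1, n + 1) (map prod.swap w)) =
    (\<Sum>A | set_mset A \<subseteq> triples n r t \<and> (\<forall>k\<in>{1..n}. size {#a \<in># A. snd (snd a) = k#} = m k).
      \<Prod>a\<in>#A. triple_weight r a :: (var, 'a :: comm_ring_1) mps)"
proof -
  let ?P = "SIGMA w:colored_mperms n m r. compat t (1, n + 1) (map prod.swap w)"
  let ?Q = "{A. set_mset A \<subseteq> triples n r t \<and> (\<forall>k\<in>{1..n}. size {#a \<in># A. snd (snd a) = k#} = m k)}"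
  let ?word = "\<lambda>v :: (nat \<times> nat \<times> nat) list. map (\<lambda>a. prod.swap (snd a)) v"
  have "(\<Sum>w\<in>colored_mperms n m r. prod_list (map (\<lambda>x. yvar (snd x)) w) *
      compat_sum (letter_weight r) t (1, n + 1) (map prod.swap w)) =
    (\<Sum>(w, fs)\<in>?P. prod_list (map (\<lambda>x. yvar (snd x)) w) *
      prod_list (map2 (\<lambda>f x. letter_weight r x ^ f) fs (map prod.swap w)) :: (var, 'a) mps)"
    unfolding compat_sum_def sum_distrib_left
    by (rule sum.Sigma) (auto simp: finite_colored_mperms finite_compat)
  also have "\<dots> = (\<Sum>A\<in>?Q. \<Prod>a\<in>#A. triple_weight r a)"
  \<comment> \<open>Cases 1 and 3 show that sorting and forgetting the order are mutually inverse,
    cases 2 and 4 that the maps land in the right sets, and case 5 compares the weights.\<close>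
  proof (rule sum.reindex_bij_witness[of _
        "\<lambda>A. (?word (sorted_list_of_multiset A), map fst (sorted_list_of_multiset A))"
        "\<lambda>(w, fs). mset (zip fs (map prod.swap w))"], goal_cases)
    case (1 p)
    then obtain w fs where p: "p = (w, fs)" and fs: "fs \<in> compat t (1, n + 1) (map prod.swap w)"
      by auto
    then have len: "length fs = length w" and sorted: "sorted (zip fs (map prod.swap w))"
      by (auto simp: compat_iff)
    have "map (\<lambda>a. prod.swap (snd a)) (zip fs (map prod.swap w)) =
        map prod.swap (map snd (zip fs (map prod.swap w)))"
      by (simp only: map_map comp_def)
    then show ?case using len sorted by (simp add: p sorted_sort_id)
  next
    case (2 p)
    then obtain w fs where p: "p = (w, fs)" and w: "w \<in> colored_mperms n m r"
      and fs: "fs \<in> compat t (1, n + 1) (map prod.swap w)"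
      by auto
    then have len: "length fs = length w" by (auto simp: compat_iff)
    have "a \<in> triples n r t" if a: "a \<in> set (zip fs (map prod.swap w))" for a
    proof -
      obtain f c k where fck: "a = (f, c, k)" by (metis prod_cases3)
      have "(k, c) \<in> set w" using set_zip_rightD[of f "(c, k)"] a fck by force
      moreover have "a \<le> (t, 1, n + 1)" using fs a unfolding compat_iff by blast
      ultimately show ?thesis using w by (auto simp: fck triples_def colored_mperms_def)
    qed
    then show ?case using w by (auto simp: p size_filter_zip[OF len] colored_mperms_def)
  next
    case (3 A)
    have "map prod.swap (?word v) = map snd v" for v by simp
    then show ?case by (simp add: zip_map_fst_snd del: map_map)
  next
    case (4 A)
    define v where "v = sorted_list_of_multiset A"
    have zip: "zip (map fst v) (map prod.swap (?word v)) = v" by (simp add: zip_map_fst_snd comp_def)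
    have v: "mset v = A" "sorted v" by (simp_all add: v_def)
    have triples: "a \<in> triples n r t" if "a \<in> set v" for a
      using 4 that by (auto simp flip: v(1))
    have "count_list (map fst (?word v)) k = m k" if "k \<in> {1..n}" for k
      using size_filter_zip[of "map fst v" "?word v" k] 4 that by (simp only: zip v length_map) simp
    moreover have "k \<in> {1..n} \<and> c \<in> {1..r k}" if "(k, c) \<in> set (?word v)" for k c
      using that triples by (fastforce simp: triples_def)
    ultimately have "?word v \<in> colored_mperms n m r" by (auto simp: colored_mperms_def simp del: map_map set_map list.set_map)
    moreover have "a \<le> (t, 1, n + 1)" if "a \<in> set v" for a
      using triples[OF that] by (auto simp: triples_def)
    then have "map fst v \<in> compat t (1, n + 1) (map prod.swap (?word v))"
      unfolding compat_iff zip using v(2) by simp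
    ultimately show ?case by (simp add: v_def)
  next
    case (5 p)
    then obtain w fs where p: "p = (w, fs)" and "fs \<in> compat t (1, n + 1) (map prod.swap w)"
      by auto
    then have "length fs = length w" by (auto simp: compat_iff)
    from prod_triple_weight_zip[OF this] show ?case by (simp add: p)
  qed
  finally show ?thesis .
qed

section \<open>Evaluation of the sum over multisets of triples\<close>

lemma mps_coeff_letter_weight: "1 \<le> r k \<Longrightarrow> mps_coeff (letter_weight r (c, k)) {#} = 0"
  unfolding letter_weight_def by (auto intro!: mps_coeff_power_eq_0 simp: mps_var.rep_eq)

text \<open>The quotient is \<open>1 / l - 1\<close>, which lies strictly between -1 and 0 for
  \<open>l > 1\<close>.\<close>

lemma floor_color: "1 \<le> l \<Longrightarrow> \<lfloor>(1 - real l) / real l\<rfloor> = (if l = 1 then 0 else - 1)"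
  by (auto simp: floor_eq_iff field_simps)

text \<open>\<open>prod_hom_sum\<close> separates the letters and
  \<open>hom_sum_weak_compositions\<close> the colors of one letter. The weights left in each class
  form a geometric progression, to which \<open>gauss_binomial_hom_sum\<close> applies.\<close>

lemma sum_triples_gauss_binomial:
  assumes "\<And>k. k \<in> {1..n} \<Longrightarrow> 1 \<le> r k"
  shows "(\<Sum>A | set_mset A \<subseteq> triples n r t \<and> (\<forall>k\<in>{1..n}. size {#a \<in># A. snd (snd a) = k#} = m k).
      \<Prod>a\<in>#A. triple_weight r a) =
    (\<Prod>k=1..n. \<Sum>i\<in>weak_compositions (m k) (r k). \<Prod>l=1..r k.
      gauss_binomial (int t + \<lfloor>(1 - real l) / real l\<rfloor> + int (i l)) (i l) (zvar k l ^ r k)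
      * yvar l ^ i l :: (var, 'a :: comm_ring_1) mps)"
proof -
  have term_eq: "hom_sum N {a \<in> {a \<in> triples n r t. snd (snd a) = k}. fst (snd a) = l} (triple_weight r) =
      gauss_binomial (int t + \<lfloor>(1 - real l) / real l\<rfloor> + int N) N (zvar k l ^ r k) *
        (yvar l ^ N :: (var, 'a) mps)"
    if kl: "k \<in> {1..n}" "l \<in> {1..r k}" for k l N
  proof -
    let ?U = "if l = 1 then Suc t else t"
    \<comment> \<open>One less than the number \<open>?U\<close> of values is \<open>t\<close> for
      color 1 and \<open>t - 1\<close> otherwise, as the floor prescribes.\<close>
    have "int t + \<lfloor>(1 - real l) / real l\<rfloor> + int N = int ?U - 1 + int N"
      using kl(2) by (simp add: floor_color)
    moreover have "gauss_binomial (int ?U - 1 + int N) N (letter_weight r (l, k)) * yvar l ^ N =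
        hom_sum N ((\<lambda>f. (f, l, k)) ` {..<?U}) (triple_weight r :: _ \<Rightarrow> (var, 'a) mps)"
      using assms[OF kl(1)]
      by (intro gauss_binomial_hom_sum) (auto simp: inj_def triple_weight_def mps_coeff_letter_weight)
    ultimately show ?thesis
      unfolding triples_class[where r = r, OF kl] by (simp only: letter_weight_def prod.case)
  qed
  have "(\<Sum>A | set_mset A \<subseteq> triples n r t \<and> (\<forall>k\<in>{1..n}. size {#a \<in># A. snd (snd a) = k#} = m k).
      \<Prod>a\<in>#A. triple_weight r a) =
    (\<Prod>k=1..n. hom_sum (m k) {a \<in> triples n r t. snd (snd a) = k} (triple_weight r :: _ \<Rightarrow> (var, 'a) mps))"
    by (rule prod_hom_sum[symmetric]) (auto simp: finite_triples, auto simp: triples_def)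
  also have "\<dots> = (\<Prod>k=1..n. \<Sum>i\<in>weak_compositions (m k) (r k). \<Prod>l=1..r k.
      hom_sum (i l) {a \<in> {a \<in> triples n r t. snd (snd a) = k}. fst (snd a) = l} (triple_weight r))"
    by (intro prod.cong refl hom_sum_weak_compositions) (auto simp: finite_triples, auto simp: triples_def)
  finally show ?thesis by (simp only: term_eq cong: prod.cong sum.cong)
qed

section \<open>The fraction attached to a word\<close>

text \<open>Each letter contributes one variable, and \<open>R\<close> bounds all colors, so the
  product over \<open>p\<close> misses none.\<close>

lemma prod_yvar_color_count:
  assumes "\<And>x. x \<in> set w \<Longrightarrow> snd x \<in> {1..R}"
  shows "(\<Prod>p=1..R. yvar p ^ color_count p w) =
    (prod_list (map (\<lambda>x. yvar (snd x)) w) :: (var, 'a :: comm_ring_1) mps)"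
  using assms
proof (induction w)
  case (Cons x w)
  have "(\<Prod>p=1..R. yvar p ^ color_count p (x # w)) =
      (\<Prod>p=1..R. (if p = snd x then yvar p else 1) * yvar p ^ color_count p w :: (var, 'a) mps)"
    by (rule prod.cong) (auto simp: color_count_def)
  then show ?case using Cons by (simp add: prod.distrib)
qed (simp add: color_count_def)

lemma prod_list_map_drop:
  fixes h :: "'b \<Rightarrow> 'a :: comm_monoid_mult"
  shows "prod_list (map h (drop i w)) = (\<Prod>j\<in>{i..<length w}. h (w ! j))"
proof (induction w arbitrary: i)
  case (Cons x w)
  show ?case
  proof (cases i)
    case 0
    then show ?thesis using Cons[of 0]
      by (simp add: prod.atLeast_Suc_lessThan prod.atLeast_Suc_lessThan_Suc_shift del: prod.op_ivl_Suc)
  next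
    case (Suc j)
    then show ?thesis using Cons[of j]
      by (simp add: prod.atLeast_Suc_lessThan_Suc_shift del: prod.op_ivl_Suc)
  qed
qed simp

text \<open>Positions in \<open>z_tail\<close> count from 1, those in \<open>drop\<close> from
  0.\<close>

lemma z_tail_Suc:
  "z_tail n r w (Suc i) = prod_list (map (letter_weight r) (drop i (map prod.swap w))) *
    (zlast :: (var, 'a :: comm_ring_1) mps)"
proof -
  have "(\<Prod>j=Suc i..length w. case ext_letter n w j of (k, c) \<Rightarrow> zvar k c ^ r k) =
      (\<Prod>j\<in>{i..<length w}. letter_weight r (prod.swap (w ! j)) :: (var, 'a) mps)"
    by (rule prod.reindex_bij_witness[of _ Suc "\<lambda>j. j - 1"])
       (auto simp: ext_letter_def letter_weight_def nth_append split: prod.splits)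
  then show ?thesis by (simp add: z_tail_def prod_list_map_drop)
qed

text \<open>A descent at list index \<open>i\<close> is the position \<open>Suc i\<close>, and the
  tail after it begins at position \<open>Suc (Suc i)\<close>.\<close>

lemma prod_z_tail_DES:
  "(\<Prod>i\<in>{i \<in> {2..length w + 1}. i - 1 \<in> DES n w}. z_tail n r w i) =
    (\<Prod>i<length w. if (map prod.swap w @ [(1, n + 1)]) ! Suc i < map prod.swap w ! i
      then z_tail n r w (Suc (Suc i)) else 1 :: (var, 'a :: comm_ring_1) mps)"
proof -
  have des: "Suc i \<in> DES n w \<longleftrightarrow> (map prod.swap w @ [(1, n + 1)]) ! Suc i < map prod.swap w ! i"
    if "i < length w" for i
  proof -
    have "map prod.swap w @ [(1, n + 1)] = map prod.swap (w @ [(n + 1, 1)])" by simp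
    moreover have "map prod.swap (w @ [(n + 1, 1)]) ! Suc i = prod.swap ((w @ [(n + 1, 1)]) ! Suc i)"
      using that by (intro nth_map) simp
    ultimately show ?thesis
      using that by (simp add: DES_def color_less_iff ext_letter_def nth_append)
  qed
  have "(\<Prod>i\<in>{i \<in> {2..length w + 1}. i - 1 \<in> DES n w}. z_tail n r w i) =
      (\<Prod>i | i < length w \<and> Suc i \<in> DES n w. z_tail n r w (Suc (Suc i)) :: (var, 'a) mps)"
    by (rule prod.reindex_bij_witness[of _ "\<lambda>i. Suc (Suc i)" "\<lambda>i. i - 2"])
       (auto simp: numeral_2_eq_2 Suc_diff_le Suc_diff_Suc)
  also have "\<dots> = (\<Prod>i<length w. if Suc i \<in> DES n w then z_tail n r w (Suc (Suc i)) else 1)"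
    by (simp add: prod.inter_filter lessThan_def flip: prod.inter_filter)
  also have "\<dots> = (\<Prod>i<length w. if (map prod.swap w @ [(1, n + 1)]) ! Suc i < map prod.swap w ! i
      then z_tail n r w (Suc (Suc i)) else 1)"
    by (rule prod.cong) (simp_all only: des lessThan_iff)
  finally show ?thesis .
qed

text \<open>\<open>compat_sum_sums\<close> gives the limit times the denominator. Every tail
  contains \<open>zlast\<close>, so the denominator is a product of units and may be divided
  out.\<close>

lemma word_fraction_sums:
  "(\<lambda>t. zlast ^ t * compat_sum (letter_weight r) t (1, n + 1) (map prod.swap w)) sums
    ((\<Prod>i\<in>{i \<in> {2..length w + 1}. i - 1 \<in> DES n w}. z_tail n r w i)
      / (\<Prod>i=1..length w + 1. 1 - z_tail n r w i) :: (var, 'a :: comm_ring_1) mps)"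
proof -
  have zlast: "mps_coeff (zlast :: (var, 'a) mps) {#} = 0" by (simp add: mps_var.rep_eq)
  let ?N = "\<Prod>i\<in>{i \<in> {2..length w + 1}. i - 1 \<in> DES n w}. z_tail n r w i :: (var, 'a) mps"
  let ?D = "\<Prod>i=1..length w + 1. 1 - z_tail n r w i :: (var, 'a) mps"
  have D: "?D = (\<Prod>i\<le>length w. 1 - z_tail n r w (Suc i))"
    by (rule prod.reindex_bij_witness[of _ Suc "\<lambda>i. i - 1"]) auto
  obtain L where L: "(\<lambda>t. zlast ^ t * compat_sum (letter_weight r) t (1, n + 1) (map prod.swap w)) sums L"
    "L * ?D = ?N"
    using compat_sum_sums[OF zlast, of "letter_weight r" "(1, n + 1)" "map prod.swap w"]
    unfolding prod_z_tail_DES D z_tail_Suc by auto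
  have "?D dvd 1"
    by (intro mps_dvd_one_prod mps_one_minus_unit)
       (simp add: z_tail_def mps_coeff_mult_empty zlast)
  then have "?N / ?D = L" using L(2) by (rule mps_divide_eqI)
  then show ?thesis using L(1) by simp
qed

section \<open>Summation over all words\<close>

theorem theorem6:
  fixes n :: nat and m r :: "nat \<Rightarrow> nat"
  assumes "n \<ge> 1"
    and "\<And>k. k \<in> {1..n} \<Longrightarrow> m k \<ge> 1"
    and "\<And>k. k \<in> {1..n} \<Longrightarrow> r k \<ge> 1"
  defines "m_sum \<equiv> (\<Sum>k=1..n. m k)"
    and "r_max \<equiv> Max (r ` {1..n})"
  shows
    "(\<lambda>t. zlast ^ t *
        (\<Prod>k=1..n. \<Sum>i\<in>weak_compositions (m k) (r k). \<Prod>l=1..r k.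
           gauss_binomial (int t + \<lfloor>(1 - real l) / real l\<rfloor> + int (i l)) (i l) (zvar k l ^ r k)
           * yvar l ^ i l))
     sums
     (\<Sum>w\<in>colored_mperms n m r.
        ((\<Prod>p=1..r_max. yvar p ^ color_count p w) *
         (\<Prod>i\<in>{i \<in> {2..m_sum + 1}. i - 1 \<in> DES n w}. z_tail n r w i))
        / (\<Prod>i=1..m_sum + 1. 1 - z_tail n r w i)
      :: (var, 'a :: comm_ring_1) mps)"
proof -
  let ?Y = "\<lambda>w. \<Prod>p=1..r_max. yvar p ^ color_count p w :: (var, 'a) mps"
  let ?S = "\<lambda>t w. compat_sum (letter_weight r) t (1, n + 1) (map prod.swap w) :: (var, 'a) mps"
  have Y: "?Y w = prod_list (map (\<lambda>x. yvar (snd x)) w)" if w: "w \<in> colored_mperms n m r" for w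
  proof (rule prod_yvar_color_count)
    fix x assume "x \<in> set w"
    then have "fst x \<in> {1..n}" "snd x \<in> {1..r (fst x)}" using w by (auto simp: colored_mperms_def)
    moreover from this have "r (fst x) \<le> r_max" unfolding r_max_def by (intro Max_ge) auto
    ultimately show "snd x \<in> {1..r_max}" by auto
  qed
  have "(\<lambda>t. \<Sum>w\<in>colored_mperms n m r. ?Y w * (zlast ^ t * ?S t w)) sums
      (\<Sum>w\<in>colored_mperms n m r. ?Y w *
        ((\<Prod>i\<in>{i \<in> {2..m_sum + 1}. i - 1 \<in> DES n w}. z_tail n r w i)
          / (\<Prod>i=1..m_sum + 1. 1 - z_tail n r w i)))"
  \<comment> \<open>The word series are scaled by their constant color factors and added termwise;
    every word has length \<open>m_sum\<close>, which unifies the index ranges.\<close>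
  proof (rule sums_sum)
    fix w assume "w \<in> colored_mperms n m r"
    then have "length w = m_sum" unfolding m_sum_def by (rule length_colored_mperm)
    from word_fraction_sums[of r n w, unfolded this]
    show "(\<lambda>t. ?Y w * (zlast ^ t * ?S t w)) sums (?Y w *
        ((\<Prod>i\<in>{i \<in> {2..m_sum + 1}. i - 1 \<in> DES n w}. z_tail n r w i)
          / (\<Prod>i=1..m_sum + 1. 1 - z_tail n r w i)))"
      unfolding sums_def by (subst sum_distrib_left[symmetric]) (intro tendsto_mult tendsto_const)
  qed
  moreover have "(\<Sum>w\<in>colored_mperms n m r. ?Y w * (zlast ^ t * ?S t w)) = zlast ^ t *
      (\<Prod>k=1..n. \<Sum>i\<in>weak_compositions (m k) (r k). \<Prod>l=1..r k.
         gauss_binomial (int t + \<lfloor>(1 - real l) / real l\<rfloor> + int (i l)) (i l) (zvar k l ^ r k)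
         * yvar l ^ i l)" for t
  proof -
    have "(\<Sum>w\<in>colored_mperms n m r. ?Y w * (zlast ^ t * ?S t w)) =
        zlast ^ t * (\<Sum>w\<in>colored_mperms n m r. prod_list (map (\<lambda>x. yvar (snd x)) w) * ?S t w)"
      unfolding sum_distrib_left by (rule sum.cong) (simp_all only: Y mult.left_commute)
    then show ?thesis
      by (simp only: sum_colored_mperms_compat sum_triples_gauss_binomial[OF assms(3)])
  qed
  ultimately show ?thesis by (simp add: divide_mps_def mult.assoc)
qed

end
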